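(* The Witt algebra on $F[t]$ and the Witt algebra on $F[t,t^{-1}]$ are both simple Lie algebras, and both are $r_b$-semisimple, i.e. their Baer radical $r_b$ is zero.
   Context: $F$ is an algebraically closed field of characteristic zero; all Lie algebras are over $F$ and may be infinite dimensional. A Lie algebra $L$ is simple if it has no non-trivial ideals and $[L,L]\neq 0$. Witt algebras. For $i\in\mathbb Z$ let $d_i = t^{i+1}\frac{d}{dt}$, a derivation of $F[t,t^{-1}]$, so that $[d_i,d_j]=(j-i)d_{i+j}$. The Witt algebra on $F[t]$ is $\sum_{i=-1}^{\infty}Fd_i$ (the span of the $d_i$, $i\ge -1$); the Witt algebra on $F[t,t^{-1}]$ is $\sum_{i=-\infty}^{\infty}Fd_i$ (the span of all $d_i$, $i\in\mathbb Z$). Baer radical. A homomorphic image of a Lie algebra $L$ is a Lie algebra onto which $L$ maps by a surjective Lie homomorphism. Let $\mathbb E$ be the class of nilpotent Lie algebras. For a well-ordered set $I$ with least element $1$ and a maximal element, define classes $\mathbb E_\alpha$ ($\alpha\in I$) by transfinite recursion: $\mathbb E_1$ is the class of all homomorphic images of members of $\mathbb E$; if $\alpha>1$ is a limit element (no immediate predecessor), $\mathbb E_\alpha=\bigcup_{\beta<\alpha}\mathbb E_\beta$; if $\alpha>1$ has an immediate predecessor $\alpha-1$, $\mathbb E_\alpha$ is the class of Lie algebras $L$ such that every non-zero homomorphic image of $L$ has a non-zero ideal belonging to $\mathbb E_{\alpha-1}$. Put $\mathbb E_I=\bigcup_{\alpha\in I}\mathbb E_\alpha$. A Lie algebra $L$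 is an $r_b$-Lie algebra if $L\in\mathbb E_I$ for some such $I$ with $\operatorname{card} I>\operatorname{card} 2^L$ ($2^L$ is the power set of $L$). An $r_b$-ideal of $L$ is an ideal which is an $r_b$-Lie algebra, and $r_b(L)$, the Baer radical, denotes the largest $r_b$-ideal of $L$ (the sum of all $r_b$-ideals). *)

theory Defs
  imports
    "HOL-Algebra.Module"
    "HOL-Algebra.Algebraic_Closure_Type"
    "HOL-Library.Poly_Mapping"
    "HOL-Library.Equipollence"
begin

section \<open>Lie algebras\<close>

text \<open>
  The ground field is the type \<open>'f\<close>, seen as a ring record through
  \<^const>\<open>ring_of_type_algebra\<close>. A Lie algebra is a \<^typ>\<open>('f, 'a) module\<close> record whose
  multiplication \<open>x \<otimes>\<^bsub>L\<^esub> y\<close> is the Lie bracket \<open>[x, y]\<close>; the field \<open>one\<close> of the record is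
  never used.
\<close>

definition lie_algebra :: "('f::field, 'a) module \<Rightarrow> bool" where
  "lie_algebra L \<longleftrightarrow>
     Module.module ring_of_type_algebra L \<and>
     (\<forall>x\<in>carrier L. \<forall>y\<in>carrier L. x \<otimes>\<^bsub>L\<^esub> y \<in> carrier L) \<and>
     (\<forall>x\<in>carrier L. \<forall>y\<in>carrier L. \<forall>z\<in>carrier L.
        (x \<oplus>\<^bsub>L\<^esub> y) \<otimes>\<^bsub>L\<^esub> z = (x \<otimes>\<^bsub>L\<^esub> z) \<oplus>\<^bsub>L\<^esub> (y \<otimes>\<^bsub>L\<^esub> z) \<and>
        z \<otimes>\<^bsub>L\<^esub> (x \<oplus>\<^bsub>L\<^esub> y) = (z \<otimes>\<^bsub>L\<^esub> x) \<oplus>\<^bsub>L\<^esub> (z \<otimes>\<^bsub>L\<^esub> y)) \<and>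
     (\<forall>c. \<forall>x\<in>carrier L. \<forall>y\<in>carrier L.
        (c \<odot>\<^bsub>L\<^esub> x) \<otimes>\<^bsub>L\<^esub> y = c \<odot>\<^bsub>L\<^esub> (x \<otimes>\<^bsub>L\<^esub> y) \<and>
        x \<otimes>\<^bsub>L\<^esub> (c \<odot>\<^bsub>L\<^esub> y) = c \<odot>\<^bsub>L\<^esub> (x \<otimes>\<^bsub>L\<^esub> y)) \<and>
     (\<forall>x\<in>carrier L. x \<otimes>\<^bsub>L\<^esub> x = \<zero>\<^bsub>L\<^esub>) \<and>
     (\<forall>x\<in>carrier L. \<forall>y\<in>carrier L. \<forall>z\<in>carrier L.
        (x \<otimes>\<^bsub>L\<^esub> (y \<otimes>\<^bsub>L\<^esub> z)) \<oplus>\<^bsub>L\<^esub> (y \<otimes>\<^bsub>L\<^esub> (z \<otimes>\<^bsub>L\<^esub> x)) \<oplus>\<^bsub>L\<^esub> (z \<otimes>\<^bsub>L\<^esub> (x \<otimes>\<^bsub>L\<^esub> y)) = \<zero>\<^bsub>L\<^esub>)"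

text \<open>
  \<^const>\<open>hull\<close> gives the linear span only for \<open>S \<subseteq> carrier L\<close>; all uses below are of this kind
  (for the Witt algebras this is \<open>witt_basis_derivation\<close>).
\<close>

definition lie_span :: "('f::field, 'a) module \<Rightarrow> 'a set \<Rightarrow> 'a set" where
  "lie_span L S = (\<lambda>H. submodule H ring_of_type_algebra L) hull S"

definition lie_ideal :: "'a set \<Rightarrow> ('f::field, 'a) module \<Rightarrow> bool" where
  "lie_ideal I L \<longleftrightarrow>
     submodule I ring_of_type_algebra L \<and> (\<forall>x\<in>carrier L. \<forall>y\<in>I. x \<otimes>\<^bsub>L\<^esub> y \<in> I)"

definition lie_product :: "('f::field, 'a) module \<Rightarrow> 'a set \<Rightarrow> 'a set \<Rightarrow> 'a set" where
  "lie_product L A B = lie_span L {x \<otimes>\<^bsub>L\<^esub> y | x y. x \<in> A \<and> y \<in> B}"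

definition simple_lie_algebra :: "('f::field, 'a) module \<Rightarrow> bool" where
  "simple_lie_algebra L \<longleftrightarrow>
     lie_algebra L \<and>
     (\<forall>I. lie_ideal I L \<longrightarrow> I = {\<zero>\<^bsub>L\<^esub>} \<or> I = carrier L) \<and>
     lie_product L (carrier L) (carrier L) \<noteq> {\<zero>\<^bsub>L\<^esub>}"

primrec lower_central_series :: "('f::field, 'a) module \<Rightarrow> nat \<Rightarrow> 'a set" where
  "lower_central_series L 0 = carrier L"
| "lower_central_series L (Suc n) = lie_product L (carrier L) (lower_central_series L n)"

definition nilpotent_lie_algebra :: "('f::field, 'a) module \<Rightarrow> bool" where
  "nilpotent_lie_algebra L \<longleftrightarrow>
     lie_algebra L \<and> (\<exists>n. lower_central_series L n = {\<zero>\<^bsub>L\<^esub>})"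

definition lie_hom :: "('f::field, 'a) module \<Rightarrow> ('f, 'b) module \<Rightarrow> ('a \<Rightarrow> 'b) set" where
  "lie_hom L M = {h \<in> carrier L \<rightarrow> carrier M.
     (\<forall>x\<in>carrier L. \<forall>y\<in>carrier L. h (x \<oplus>\<^bsub>L\<^esub> y) = h x \<oplus>\<^bsub>M\<^esub> h y \<and> h (x \<otimes>\<^bsub>L\<^esub> y) = h x \<otimes>\<^bsub>M\<^esub> h y) \<and>
     (\<forall>c. \<forall>x\<in>carrier L. h (c \<odot>\<^bsub>L\<^esub> x) = c \<odot>\<^bsub>M\<^esub> h x)}"

text \<open>
  \<open>L\<close> and its image share one carrier type. This loses no homomorphic image up to isomorphism:
  a quotient of \<open>L\<close> is in bijection with a set of coset representatives in \<open>carrier L\<close>.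
\<close>

definition homomorphic_image :: "('f::field, 'a) module \<Rightarrow> ('f, 'a) module \<Rightarrow> bool" where
  "homomorphic_image M L \<longleftrightarrow>
     lie_algebra L \<and> lie_algebra M \<and> (\<exists>h\<in>lie_hom L M. h ` carrier L = carrier M)"


section \<open>The Baer radical\<close>

text \<open>
  A well-ordered index set \<open>I\<close> is a reflexive well-order \<open>r\<close> with \<open>I = Field r\<close>.
\<close>

definition least_index :: "'i rel \<Rightarrow> 'i \<Rightarrow> bool" where
  "least_index r \<alpha> \<longleftrightarrow> \<alpha> \<in> Field r \<and> (\<forall>\<beta>\<in>Field r. (\<alpha>, \<beta>) \<in> r)"

definition immediate_predecessor :: "'i rel \<Rightarrow> 'i \<Rightarrow> 'i \<Rightarrow> bool" where
  "immediate_predecessor r \<beta> \<alpha> \<longleftrightarrow>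
     (\<beta>, \<alpha>) \<in> r - Id \<and> (\<forall>\<gamma>. (\<gamma>, \<alpha>) \<in> r - Id \<longrightarrow> (\<gamma>, \<beta>) \<in> r)"

definition limit_index :: "'i rel \<Rightarrow> 'i \<Rightarrow> bool" where
  "limit_index r \<alpha> \<longleftrightarrow>
     \<alpha> \<in> Field r \<and> \<not> least_index r \<alpha> \<and> (\<nexists>\<beta>. immediate_predecessor r \<beta> \<alpha>)"

text \<open>
  \<open>baer_class r \<alpha> L\<close> means \<open>L \<in> \<bbbE>\<^sub>\<alpha>\<close>. Every index is exactly one of least, limit or successor, and
  the class at \<open>\<alpha>\<close> refers only to smaller indices, so for a well-order \<open>r\<close> this inductive
  definition is the transfinite recursion.
\<close>

inductive baer_class :: "'i rel \<Rightarrow> 'i \<Rightarrow> ('f::field, 'a) module \<Rightarrow> bool" for r where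
  least:
    "\<lbrakk>least_index r \<alpha>; nilpotent_lie_algebra N; homomorphic_image L N\<rbrakk> \<Longrightarrow> baer_class r \<alpha> L"
| limit:
    "\<lbrakk>limit_index r \<alpha>; (\<beta>, \<alpha>) \<in> r - Id; baer_class r \<beta> L\<rbrakk> \<Longrightarrow> baer_class r \<alpha> L"
| successor:
    "\<lbrakk>immediate_predecessor r \<beta> \<alpha>; lie_algebra L;
      \<forall>M. homomorphic_image M L \<and> carrier M \<noteq> {\<zero>\<^bsub>M\<^esub>} \<longrightarrow>
        (\<exists>J. lie_ideal J M \<and> J \<noteq> {\<zero>\<^bsub>M\<^esub>} \<and> baer_class r \<beta> (M\<lparr>carrier := J\<rparr>))\<rbrakk>
     \<Longrightarrow> baer_class r \<alpha> L"

text \<open>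
  HOL cannot quantify over types inside a definition, so the type \<open>'i\<close> containing the index sets
  is a parameter. Only an \<open>'i\<close> with more elements than the power set of \<open>L\<close> is of interest, and a
  statement about all index sets is a statement that is polymorphic in \<open>'i\<close>.
\<close>

definition rb_lie_algebra :: "'i itself \<Rightarrow> ('f::field, 'a) module \<Rightarrow> bool" where
  "rb_lie_algebra (_ :: 'i itself) L \<longleftrightarrow>
     (\<exists>r :: 'i rel. Well_order r \<and> (\<exists>m\<in>Field r. \<forall>\<alpha>\<in>Field r. (\<alpha>, m) \<in> r) \<and>
        Pow (carrier L) \<prec> Field r \<and> (\<exists>\<alpha>\<in>Field r. baer_class r \<alpha> L))"

definition rb_ideal :: "'i itself \<Rightarrow> 'a set \<Rightarrow> ('f::field, 'a) module \<Rightarrow> bool" where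
  "rb_ideal T I L \<longleftrightarrow> lie_ideal I L \<and> rb_lie_algebra T (L\<lparr>carrier := I\<rparr>)"

text \<open>The span of the union of all \<open>r\<^sub>b\<close>-ideals is their sum.\<close>

definition baer_radical :: "'i itself \<Rightarrow> ('f::field, 'a) module \<Rightarrow> 'a set" where
  "baer_radical T L = lie_span L (\<Union>{I. rb_ideal T I L})"

definition rb_semisimple :: "'i itself \<Rightarrow> ('f::field, 'a) module \<Rightarrow> bool" where
  "rb_semisimple T L \<longleftrightarrow> baer_radical T L = {\<zero>\<^bsub>L\<^esub>}"


section \<open>Witt algebras\<close>

text \<open>
  Laurent polynomials are finitely supported functions on the exponents with convolution as
  product: \<open>single k c\<close> is \<open>c t\<^sup>k\<close>, and \<open>single 0 c\<close> is the constant \<open>c\<close>.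
\<close>

type_synonym 'f laurent_poly = "int \<Rightarrow>\<^sub>0 'f"

definition laurent_deriv :: "'f::field laurent_poly \<Rightarrow> 'f laurent_poly" where
  "laurent_deriv p =
     (\<Sum>k\<in>Poly_Mapping.keys p. Poly_Mapping.single (k - 1) (of_int k * Poly_Mapping.lookup p k))"

definition laurent_derivation :: "('f::field laurent_poly \<Rightarrow> 'f laurent_poly) \<Rightarrow> bool" where
  "laurent_derivation D \<longleftrightarrow>
     (\<forall>p q. D (p + q) = D p + D q) \<and>
     (\<forall>c p. D (Poly_Mapping.single 0 c * p) = Poly_Mapping.single 0 c * D p) \<and>
     (\<forall>p q. D (p * q) = D p * q + p * D q)"

definition laurent_derivations ::
    "('f::field, 'f laurent_poly \<Rightarrow> 'f laurent_poly) module" where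
  "laurent_derivations =
     \<lparr>carrier = {D. laurent_derivation D},
      monoid.mult = (\<lambda>D E p. D (E p) - E (D p)),
      one = undefined,
      ring.zero = (\<lambda>_. 0),
      add = (\<lambda>D E p. D p + E p),
      module.smult = (\<lambda>c D p. Poly_Mapping.single 0 c * D p)\<rparr>"

definition witt_basis :: "int \<Rightarrow> 'f::field laurent_poly \<Rightarrow> 'f laurent_poly" where
  "witt_basis i p = Poly_Mapping.single (i + 1) 1 * laurent_deriv p"

lemma lookup_laurent_deriv:
  "Poly_Mapping.lookup (laurent_deriv p) k = of_int (k + 1) * Poly_Mapping.lookup p (k + 1)"
proof -
  have "Poly_Mapping.lookup (laurent_deriv p) k =
      (\<Sum>j\<in>Poly_Mapping.keys p. if j = k + 1 then of_int j * Poly_Mapping.lookup p j else 0)"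
    unfolding laurent_deriv_def lookup_sum
    by (intro sum.cong) (auto simp: lookup_single when_def)
  also have "\<dots> = of_int (k + 1) * Poly_Mapping.lookup p (k + 1)"
    by (subst sum.delta) (auto simp: in_keys_iff)
  finally show ?thesis .
qed

lemma laurent_deriv_add: "laurent_deriv (p + q) = laurent_deriv p + laurent_deriv q"
  by (rule poly_mapping_eqI) (simp add: lookup_laurent_deriv lookup_add algebra_simps)

lemma laurent_deriv_single:
  "laurent_deriv (Poly_Mapping.single k c) = Poly_Mapping.single (k - 1) (of_int k * c)"
  by (rule poly_mapping_eqI) (auto simp: lookup_laurent_deriv lookup_single when_def)

lemma laurent_poly_induct [case_names add single]:
  fixes p :: "'f::field laurent_poly"
  assumes "\<And>p q. P p \<Longrightarrow> P q \<Longrightarrow> P (p + q)" "\<And>k c. P (Poly_Mapping.single k c)"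
  shows "P p"
proof -
  have "P (\<Sum>k\<in>A. Poly_Mapping.single k (Poly_Mapping.lookup p k))" if "finite A" for A
    using that
  proof (induction A rule: finite_induct)
    case empty
    then show ?case using assms(2)[of 0 0] by simp
  next
    case (insert k A)
    then show ?case using assms by simp
  qed
  moreover have "(\<Sum>k\<in>Poly_Mapping.keys p. Poly_Mapping.single k (Poly_Mapping.lookup p k)) = p"
    by (rule poly_mapping_eqI)
       (auto simp: lookup_sum lookup_single when_def in_keys_iff)
  ultimately show ?thesis by (metis finite_keys)
qed

lemma laurent_deriv_mult:
  "laurent_deriv (p * q) = laurent_deriv p * q + p * laurent_deriv q"
proof (induction p rule: laurent_poly_induct)
  case (add p p')
  then show ?case by (simp add: distrib_right laurent_deriv_add algebra_simps)
next
  case (single k c)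
  show ?case
  proof (induction q rule: laurent_poly_induct)
    case (add q q')
    then show ?case by (simp add: distrib_left laurent_deriv_add algebra_simps)
  next
    case (single l d)
    have "k - 1 + l = k + l - 1" "k + (l - 1) = k + l - 1" by auto
    then show ?case
      by (simp add: mult_single laurent_deriv_single algebra_simps flip: single_add)
  qed
qed

lemma witt_basis_derivation: "laurent_derivation (witt_basis i)"
proof -
  have "laurent_deriv (Poly_Mapping.single 0 c) = 0" for c :: 'a
    by (simp add: laurent_deriv_single)
  then show ?thesis
    unfolding laurent_derivation_def witt_basis_def
    by (auto simp: laurent_deriv_add laurent_deriv_mult algebra_simps)
qed

lemma witt_basis_bracket:
  "witt_basis i \<otimes>\<^bsub>laurent_derivations\<^esub> witt_basis j =
     of_int (j - i) \<odot>\<^bsub>laurent_derivations\<^esub> witt_basis (i + j)"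
proof (rule ext)
  fix p
  show "(witt_basis i \<otimes>\<^bsub>laurent_derivations\<^esub> witt_basis j) p =
     (of_int (j - i) \<odot>\<^bsub>laurent_derivations\<^esub> witt_basis (i + j)) p"
  proof (induction p rule: laurent_poly_induct)
    case (add p q)
    then show ?case
      by (simp add: laurent_derivations_def witt_basis_def laurent_deriv_add algebra_simps)
  next
    case (single k c)
    have "i + 1 + (j + 1 + (k - 1) - 1) = i + j + k" "j + 1 + (i + 1 + (k - 1) - 1) = i + j + k"
      "i + j + 1 + (k - 1) = i + j + k" by auto
    then show ?case
      by (simp add: laurent_derivations_def witt_basis_def laurent_deriv_single mult_single
            algebra_simps flip: single_diff single_add)
  qed
qed

text \<open>
  Both Witt algebras are spans inside the derivations of the Laurent polynomials, as
  \<open>d\<^sub>i = t\<^bsup>i+1\<^esup> d/dt\<close> is a derivation of \<open>F[t, t\<^sup>-\<^sup>1]\<close> for every \<open>i\<close>.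
\<close>

definition witt_span ::
    "int set \<Rightarrow> ('f::field, 'f laurent_poly \<Rightarrow> 'f laurent_poly) module" where
  "witt_span J =
     laurent_derivations\<lparr>carrier := lie_span laurent_derivations (witt_basis ` J)\<rparr>"

definition witt_poly :: "('f::field, 'f laurent_poly \<Rightarrow> 'f laurent_poly) module" where
  "witt_poly = witt_span {-1..}"

definition witt_laurent :: "('f::field, 'f laurent_poly \<Rightarrow> 'f laurent_poly) module" where
  "witt_laurent = witt_span UNIV"

end

theory Submission
  imports Defs
begin

text \<open>
  A simple Lie algebra is perfect, hence not an image of a nilpotent one, and it is its only non-zero
  ideal, so by induction along the hierarchy of classes no class contains it. The Baer radical of a
  simple Lie algebra therefore vanishes.

  For the simplicity of the Witt algebras, let \<open>x\<close> be an element of minimal support of a non-zero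
  ideal. For \<open>d\<^sub>m\<close> in its support, \<open>[d\<^sub>0, x] - m x\<close> has smaller support, so \<open>x\<close> is a multiple of
  \<open>d\<^sub>m\<close>. Brackets with \<open>d\<^sub>1\<close> and \<open>d\<^sub>-\<^sub>1\<close> then lead to \<open>d\<^sub>0\<close>, and brackets with \<open>d\<^sub>0\<close> give all \<open>d\<^sub>j\<close>.
\<close>

section \<open>Submodules, spans and ideals\<close>

lemma ring_of_type_algebra_simps [simp]:
  "carrier ring_of_type_algebra = UNIV" "x \<oplus>\<^bsub>ring_of_type_algebra\<^esub> y = x + y"
  "x \<otimes>\<^bsub>ring_of_type_algebra\<^esub> y = x * y" "\<zero>\<^bsub>ring_of_type_algebra\<^esub> = 0"
  "\<one>\<^bsub>ring_of_type_algebra\<^esub> = 1"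
  by (simp_all add: ring_of_type_algebra_def)

text \<open>A \<open>submodule\<close> is by definition also a subgroup of the additive group.
  Closure under inverses comes for free, since the inverse of x is the multiple of x by -1.\<close>

lemma submodule_iff:
  fixes L :: "('f::field, 'a) module"
  assumes "Module.module ring_of_type_algebra L"
  shows "submodule H ring_of_type_algebra L \<longleftrightarrow>
    H \<subseteq> carrier L \<and> \<zero>\<^bsub>L\<^esub> \<in> H \<and> (\<forall>x\<in>H. \<forall>y\<in>H. x \<oplus>\<^bsub>L\<^esub> y \<in> H) \<and> (\<forall>c. \<forall>x\<in>H. c \<odot>\<^bsub>L\<^esub> x \<in> H)"
    (is "_ \<longleftrightarrow> ?R")
proof
  interpret M: Module.module ring_of_type_algebra L by fact
  show ?R if H: "submodule H ring_of_type_algebra L"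
  proof -
    interpret H: submodule H ring_of_type_algebra L by fact
    show ?R
      using H.one_closed H.smult_closed M.submoduleE(1,5)[OF H] by auto
  qed
  assume R: ?R
  have "\<ominus>\<^bsub>L\<^esub> x \<in> H" if x: "x \<in> H" for x
  proof -
    have "x \<in> carrier L" using R x by auto
    \<comment> \<open>Uniqueness of inverses identifies the inverse in the record with that of the
      field type.\<close>
    moreover have "\<ominus>\<^bsub>ring_of_type_algebra\<^esub> (1::'f) = - 1"
      using M.R.minus_equality[of "-1" "1::'f"] by simp
    ultimately have "\<ominus>\<^bsub>L\<^esub> x = (- 1) \<odot>\<^bsub>L\<^esub> x"
      using M.smult_l_minus[of 1 x] M.smult_one[of x] by simp
    then show ?thesis using R x by simp
  qed
  then show "submodule H ring_of_type_algebra L"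
    using R by (intro M.submoduleI) auto
qed

lemma lie_algebra_module: "lie_algebra L \<Longrightarrow> Module.module ring_of_type_algebra L"
  by (simp add: lie_algebra_def)

lemmas lie_submodule_iff = submodule_iff[OF lie_algebra_module]

lemma submodule_subset:
  assumes "submodule H R M"
  shows "H \<subseteq> carrier M"
  using subgroup.subset[OF submodule.axioms(1)[OF assms]] by simp

lemma submodule_carrier:
  "lie_algebra L \<Longrightarrow> submodule (carrier L) ring_of_type_algebra L"
  by (simp add: lie_algebra_module module.carrier_is_submodule)

lemma lie_zero_closed: "lie_algebra L \<Longrightarrow> \<zero>\<^bsub>L\<^esub> \<in> carrier L"
  by (simp add: lie_submodule_iff[THEN iffD1, OF _ submodule_carrier])

text \<open>The hull is the intersection of all submodules containing S. One of them is
  \<open>carrier L\<close>, which keeps the intersection inside the algebra.\<close>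

lemma submodule_lie_span:
  assumes "lie_algebra L" "S \<subseteq> carrier L"
  shows "submodule (lie_span L S) ring_of_type_algebra L"
proof -
  have "lie_span L S \<subseteq> carrier L"
    unfolding lie_span_def using assms submodule_carrier by (intro hull_minimal) auto
  then show ?thesis
    unfolding lie_submodule_iff[OF assms(1)]
    by (auto simp: lie_span_def hull_def lie_submodule_iff[OF assms(1)])
qed

lemma lie_span_minimal:
  "S \<subseteq> H \<Longrightarrow> submodule H ring_of_type_algebra L \<Longrightarrow> lie_span L S \<subseteq> H"
  unfolding lie_span_def by (rule hull_minimal)

lemma lie_span_superset: "S \<subseteq> lie_span L S"
  unfolding lie_span_def by (rule hull_subset)

section \<open>Brackets and subalgebras generated as spans\<close>

lemma lie_bracket_closed:
  "lie_algebra L \<Longrightarrow> x \<in> carrier L \<Longrightarrow> y \<in> carrier L \<Longrightarrow> x \<otimes>\<^bsub>L\<^esub> y \<in> carrier L"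
  unfolding lie_algebra_def by blast

lemma lie_algebra_smult_zero:
  assumes "lie_algebra L" "x \<in> carrier L"
  shows "0 \<odot>\<^bsub>L\<^esub> x = \<zero>\<^bsub>L\<^esub>"
  using module.smult_l_null[OF lie_algebra_module[OF assms(1)] assms(2)] by simp

lemma lie_bracket_zero:
  assumes L: "lie_algebra L" and x: "x \<in> carrier L"
  shows "\<zero>\<^bsub>L\<^esub> \<otimes>\<^bsub>L\<^esub> x = \<zero>\<^bsub>L\<^esub>" "x \<otimes>\<^bsub>L\<^esub> \<zero>\<^bsub>L\<^esub> = \<zero>\<^bsub>L\<^esub>"
proof -
  have z: "\<zero>\<^bsub>L\<^esub> \<in> carrier L"
    using L by (rule lie_zero_closed)
  have "(0 \<odot>\<^bsub>L\<^esub> x) \<otimes>\<^bsub>L\<^esub> x = 0 \<odot>\<^bsub>L\<^esub> (x \<otimes>\<^bsub>L\<^esub> x)" "x \<otimes>\<^bsub>L\<^esub> (0 \<odot>\<^bsub>L\<^esub> x) = 0 \<odot>\<^bsub>L\<^esub> (x \<otimes>\<^bsub>L\<^esub> x)"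
    "x \<otimes>\<^bsub>L\<^esub> x \<in> carrier L"
    using L x unfolding lie_algebra_def by blast+
  then show "\<zero>\<^bsub>L\<^esub> \<otimes>\<^bsub>L\<^esub> x = \<zero>\<^bsub>L\<^esub>" "x \<otimes>\<^bsub>L\<^esub> \<zero>\<^bsub>L\<^esub> = \<zero>\<^bsub>L\<^esub>"
    by (simp_all add: lie_algebra_smult_zero L x)
qed

lemma lie_subalgebra:
  assumes L: "lie_algebra L" and H: "submodule H ring_of_type_algebra L"
    and closed: "\<And>x y. x \<in> H \<Longrightarrow> y \<in> H \<Longrightarrow> x \<otimes>\<^bsub>L\<^esub> y \<in> H"
  shows "lie_algebra (L\<lparr>carrier := H\<rparr>)"
proof -
  have "Module.module ring_of_type_algebra (L\<lparr>carrier := H\<rparr>)"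
    by (rule submodule.submodule_is_module[OF H lie_algebra_module[OF L]])
  moreover have "H \<subseteq> carrier L"
    using H by (rule submodule_subset)
  ultimately show ?thesis
    using L closed unfolding lie_algebra_def by (simp add: subset_iff)
qed

lemma submodule_bracket_vimage:
  assumes L: "lie_algebra L" and S: "submodule S ring_of_type_algebra L" and x: "x \<in> carrier L"
  shows "submodule {y \<in> S. x \<otimes>\<^bsub>L\<^esub> y \<in> S} ring_of_type_algebra L"
    and "submodule {y \<in> S. y \<otimes>\<^bsub>L\<^esub> x \<in> S} ring_of_type_algebra L"
proof -
  note iff = lie_submodule_iff[OF L]
  note S' = S[unfolded iff]
  have add: "x \<otimes>\<^bsub>L\<^esub> (y \<oplus>\<^bsub>L\<^esub> z) = (x \<otimes>\<^bsub>L\<^esub> y) \<oplus>\<^bsub>L\<^esub> (x \<otimes>\<^bsub>L\<^esub> z)"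
      "(y \<oplus>\<^bsub>L\<^esub> z) \<otimes>\<^bsub>L\<^esub> x = (y \<otimes>\<^bsub>L\<^esub> x) \<oplus>\<^bsub>L\<^esub> (z \<otimes>\<^bsub>L\<^esub> x)"
    if "y \<in> S" "z \<in> S" for y z
  proof -
    have "y \<in> carrier L" "z \<in> carrier L" using that S' by blast+
    then show "x \<otimes>\<^bsub>L\<^esub> (y \<oplus>\<^bsub>L\<^esub> z) = (x \<otimes>\<^bsub>L\<^esub> y) \<oplus>\<^bsub>L\<^esub> (x \<otimes>\<^bsub>L\<^esub> z)"
      "(y \<oplus>\<^bsub>L\<^esub> z) \<otimes>\<^bsub>L\<^esub> x = (y \<otimes>\<^bsub>L\<^esub> x) \<oplus>\<^bsub>L\<^esub> (z \<otimes>\<^bsub>L\<^esub> x)"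
      using L x unfolding lie_algebra_def by blast+
  qed
  have smult: "x \<otimes>\<^bsub>L\<^esub> (c \<odot>\<^bsub>L\<^esub> y) = c \<odot>\<^bsub>L\<^esub> (x \<otimes>\<^bsub>L\<^esub> y)"
      "(c \<odot>\<^bsub>L\<^esub> y) \<otimes>\<^bsub>L\<^esub> x = c \<odot>\<^bsub>L\<^esub> (y \<otimes>\<^bsub>L\<^esub> x)"
    if "y \<in> S" for c y
  proof -
    have "y \<in> carrier L" using that S' by blast
    then show "x \<otimes>\<^bsub>L\<^esub> (c \<odot>\<^bsub>L\<^esub> y) = c \<odot>\<^bsub>L\<^esub> (x \<otimes>\<^bsub>L\<^esub> y)"
      "(c \<odot>\<^bsub>L\<^esub> y) \<otimes>\<^bsub>L\<^esub> x = c \<odot>\<^bsub>L\<^esub> (y \<otimes>\<^bsub>L\<^esub> x)"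
      using L x unfolding lie_algebra_def by blast+
  qed
  show "submodule {y \<in> S. x \<otimes>\<^bsub>L\<^esub> y \<in> S} ring_of_type_algebra L"
    and "submodule {y \<in> S. y \<otimes>\<^bsub>L\<^esub> x \<in> S} ring_of_type_algebra L"
    unfolding iff using S' by (auto simp: lie_bracket_zero[OF L x] add smult)
qed

text \<open>Bilinearity in two rounds. For a generator on the left, the admissible right arguments
  form a submodule containing B, hence the whole span. Then, for a fixed y in the span, the
  admissible left arguments form such a submodule too.\<close>

lemma lie_span_bracket_closed:
  assumes L: "lie_algebra L" and B: "B \<subseteq> carrier L"
    and gen: "\<And>x y. x \<in> B \<Longrightarrow> y \<in> B \<Longrightarrow> x \<otimes>\<^bsub>L\<^esub> y \<in> lie_span L B"
    and x: "x \<in> lie_span L B" and y: "y \<in> lie_span L B"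
  shows "x \<otimes>\<^bsub>L\<^esub> y \<in> lie_span L B"
proof -
  let ?S = "lie_span L B"
  have S: "submodule ?S ring_of_type_algebra L"
    using L B by (rule submodule_lie_span)
  have B_S: "B \<subseteq> ?S" by (rule lie_span_superset)
  have "?S \<subseteq> {y \<in> ?S. x \<otimes>\<^bsub>L\<^esub> y \<in> ?S}" if "x \<in> B" for x
    using that B B_S gen
    by (intro lie_span_minimal submodule_bracket_vimage(1)[OF L S]) auto
  then have "B \<subseteq> {x \<in> ?S. x \<otimes>\<^bsub>L\<^esub> y \<in> ?S}" using B_S y by blast
  moreover have "y \<in> carrier L" using y submodule_subset[OF S] by blast
  ultimately have "?S \<subseteq> {x \<in> ?S. x \<otimes>\<^bsub>L\<^esub> y \<in> ?S}"
    by (intro lie_span_minimal submodule_bracket_vimage(2)[OF L S])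
  then show ?thesis using x by auto
qed

lemma submodule_zero:
  assumes L: "lie_algebra L"
  shows "submodule {\<zero>\<^bsub>L\<^esub>} ring_of_type_algebra L"
proof -
  interpret Module.module ring_of_type_algebra L
    using L by (rule lie_algebra_module)
  show ?thesis unfolding lie_submodule_iff[OF L]
    using smult_r_null by auto
qed

section \<open>The Baer radical of a simple Lie algebra\<close>

lemma submodule_lie_product:
  assumes L: "lie_algebra L" and "A \<subseteq> carrier L" "B \<subseteq> carrier L"
  shows "submodule (lie_product L A B) ring_of_type_algebra L"
  unfolding lie_product_def
  by (rule submodule_lie_span[OF L]) (use assms(2,3) lie_bracket_closed[OF L] in auto)

text \<open>[L, L] is an ideal, and it is non-zero by the definition of simplicity.\<close>

lemma simple_lie_algebra_perfect:
  assumes "simple_lie_algebra L"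
  shows "lie_product L (carrier L) (carrier L) = carrier L"
proof -
  have L: "lie_algebra L" using assms by (simp add: simple_lie_algebra_def)
  let ?P = "lie_product L (carrier L) (carrier L)"
  have sub: "submodule ?P ring_of_type_algebra L"
    by (rule submodule_lie_product[OF L order.refl order.refl])
  then have "?P \<subseteq> carrier L" by (rule submodule_subset)
  moreover have "{x \<otimes>\<^bsub>L\<^esub> y |x y. x \<in> carrier L \<and> y \<in> carrier L} \<subseteq> ?P"
    unfolding lie_product_def by (rule lie_span_superset)
  ultimately have "lie_ideal ?P L"
    using sub unfolding lie_ideal_def by blast
  then show ?thesis using assms by (auto simp: simple_lie_algebra_def)
qed

section \<open>Images of nilpotent Lie algebras\<close>

lemma submodule_lower_central_series:
  assumes L: "lie_algebra L"
  shows "submodule (lower_central_series L n) ring_of_type_algebra L"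
proof (induction n)
  case (Suc n)
  then have "lower_central_series L n \<subseteq> carrier L"
    by (rule submodule_subset)
  then show ?case by (simp add: submodule_lie_product L)
qed (simp add: submodule_carrier L)

lemma lie_hom_zero:
  assumes "lie_algebra L" "lie_algebra M" "h \<in> lie_hom L M"
  shows "h \<zero>\<^bsub>L\<^esub> = \<zero>\<^bsub>M\<^esub>"
proof -
  have z: "\<zero>\<^bsub>L\<^esub> \<in> carrier L"
    using assms(1) by (rule lie_zero_closed)
  then have "h (0 \<odot>\<^bsub>L\<^esub> \<zero>\<^bsub>L\<^esub>) = 0 \<odot>\<^bsub>M\<^esub> h \<zero>\<^bsub>L\<^esub>" "h \<zero>\<^bsub>L\<^esub> \<in> carrier M"
    using assms(3) by (auto simp: lie_hom_def)
  then show ?thesis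
    using assms z by (simp add: lie_algebra_smult_zero)
qed

lemma submodule_lie_hom_image:
  assumes L: "lie_algebra L" and M: "lie_algebra M" and h: "h \<in> lie_hom L M"
    and H: "submodule H ring_of_type_algebra L"
  shows "submodule (h ` H) ring_of_type_algebra M"
  unfolding lie_submodule_iff[OF M]
proof (intro conjI ballI allI)
  note H' = H[unfolded lie_submodule_iff[OF L]]
  show "h ` H \<subseteq> carrier M" using H' h by (auto simp: lie_hom_def)
  show "\<zero>\<^bsub>M\<^esub> \<in> h ` H" using H' lie_hom_zero[OF L M h] by (metis imageI)
  show "x \<oplus>\<^bsub>M\<^esub> y \<in> h ` H" if xy: "x \<in> h ` H" "y \<in> h ` H" for x y
  proof -
    obtain a b where ab: "x = h a" "y = h b" "a \<in> H" "b \<in> H" using xy by auto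
    then have "x \<oplus>\<^bsub>M\<^esub> y = h (a \<oplus>\<^bsub>L\<^esub> b)"
      using H' h by (auto simp: lie_hom_def subset_iff)
    then show ?thesis using H' ab by auto
  qed
  show "c \<odot>\<^bsub>M\<^esub> x \<in> h ` H" if x: "x \<in> h ` H" for c x
  proof -
    obtain a where a: "x = h a" "a \<in> H" using x by auto
    then have "c \<odot>\<^bsub>M\<^esub> x = h (c \<odot>\<^bsub>L\<^esub> a)"
      using H' h by (auto simp: lie_hom_def subset_iff)
    then show ?thesis using H' a by auto
  qed
qed

text \<open>As L is perfect, every term of the lower central series of N still maps onto L. When the
  series reaches zero, L would be zero.\<close>

lemma simple_not_image_of_nilpotent:
  assumes simple: "simple_lie_algebra L" and nil: "nilpotent_lie_algebra N"
  shows "\<not> homomorphic_image L N"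
proof
  assume "homomorphic_image L N"
  then obtain h where N: "lie_algebra N" and L: "lie_algebra L"
    and h: "h \<in> lie_hom N L" and surj: "h ` carrier N = carrier L"
    by (auto simp: homomorphic_image_def)
  have "carrier L \<subseteq> h ` lower_central_series N n" for n
  proof (induction n)
    case (Suc n)
    let ?C = "lower_central_series N n"
    have sub: "?C \<subseteq> carrier N"
      by (rule submodule_subset[OF submodule_lower_central_series[OF N]])
    have "lie_product L (carrier L) (carrier L) \<subseteq> h ` lower_central_series N (Suc n)"
      unfolding lie_product_def
    proof (rule lie_span_minimal)
      show "submodule (h ` lower_central_series N (Suc n)) ring_of_type_algebra L"
        by (intro submodule_lie_hom_image[OF N L h] submodule_lower_central_series N)
      show "{x \<otimes>\<^bsub>L\<^esub> y |x y. x \<in> carrier L \<and> y \<in> carrier L} \<subseteq> h ` lower_central_series N (Suc n)"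
      proof clarify
        fix x y assume "x \<in> carrier L" "y \<in> carrier L"
        \<comment> \<open>x lifts to N by surjectivity and y lifts to the n-th term by induction, so
          the bracket of the lifts lies in the next term.\<close>
        then obtain a b where ab: "x = h a" "a \<in> carrier N" "y = h b" "b \<in> ?C"
          using surj Suc.IH by blast
        then have "x \<otimes>\<^bsub>L\<^esub> y = h (a \<otimes>\<^bsub>N\<^esub> b)"
          using h sub by (auto simp: lie_hom_def subset_iff)
        moreover have "a \<otimes>\<^bsub>N\<^esub> b \<in> {x \<otimes>\<^bsub>N\<^esub> y |x y. x \<in> carrier N \<and> y \<in> ?C}"
          using ab by blast
        then have "a \<otimes>\<^bsub>N\<^esub> b \<in> lower_central_series N (Suc n)"
          unfolding lower_central_series.simps lie_product_def
          by (rule subsetD[OF lie_span_superset])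
        ultimately show "x \<otimes>\<^bsub>L\<^esub> y \<in> h ` lower_central_series N (Suc n)" by blast
      qed
    qed
    then show ?case using simple_lie_algebra_perfect[OF simple] by simp
  qed (use surj in simp)
  moreover obtain n where "lower_central_series N n = {\<zero>\<^bsub>N\<^esub>}"
    using nil by (auto simp: nilpotent_lie_algebra_def)
  ultimately have "carrier L \<subseteq> {\<zero>\<^bsub>L\<^esub>}"
    using lie_hom_zero[OF N L h] by (metis image_empty image_insert)
  moreover have "\<zero>\<^bsub>L\<^esub> \<in> carrier L"
    using L by (rule lie_zero_closed)
  ultimately have "carrier L = {\<zero>\<^bsub>L\<^esub>}" by blast
  then show False
    using simple simple_lie_algebra_perfect[OF simple] by (simp add: simple_lie_algebra_def)
qed

lemma homomorphic_image_refl: "lie_algebra L \<Longrightarrow> homomorphic_image L L"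
  unfolding homomorphic_image_def
  by (auto simp: lie_hom_def intro!: bexI[where x = "\<lambda>x. x"])

lemma simple_carrier_nonzero:
  assumes "simple_lie_algebra L"
  shows "carrier L \<noteq> {\<zero>\<^bsub>L\<^esub>}"
  using assms simple_lie_algebra_perfect[OF assms] by (simp add: simple_lie_algebra_def)

section \<open>The class hierarchy and the radical\<close>

text \<open>Induction on the rules for the classes. A limit stage only repeats an earlier
  membership. At a successor, L is taken as its own image; the non-zero ideal found there must be L,
  which would already be in the preceding class.\<close>

lemma baer_class_not_simple: "baer_class r \<alpha> L \<Longrightarrow> \<not> simple_lie_algebra L"
proof (induction rule: baer_class.induct)
  case (least \<alpha> N L)
  then show ?case using simple_not_image_of_nilpotent by blast
next
  case (successor \<beta> \<alpha> L)
  show ?case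
  proof
    assume simple: "simple_lie_algebra L"
    then obtain J where J: "lie_ideal J L" "J \<noteq> {\<zero>\<^bsub>L\<^esub>}"
        "\<not> simple_lie_algebra (L\<lparr>carrier := J\<rparr>)"
      using successor.IH homomorphic_image_refl[OF successor.hyps(2)] simple_carrier_nonzero
      by blast
    then have "J = carrier L" using simple by (auto simp: simple_lie_algebra_def)
    then show False using J simple by simp
  qed
qed

lemma simple_imp_rb_semisimple:
  assumes simple: "simple_lie_algebra L"
  shows "rb_semisimple TYPE('i) L"
proof -
  have L: "lie_algebra L" using simple by (simp add: simple_lie_algebra_def)
  have "I = {\<zero>\<^bsub>L\<^esub>}" if I: "rb_ideal TYPE('i) I L" for I
  proof (rule ccontr)
    assume "I \<noteq> {\<zero>\<^bsub>L\<^esub>}"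
    then have "I = carrier L"
      using I simple by (auto simp: rb_ideal_def simple_lie_algebra_def)
    then have "rb_lie_algebra TYPE('i) L" using I by (simp add: rb_ideal_def)
    then show False
      using simple by (auto simp: rb_lie_algebra_def dest: baer_class_not_simple)
  qed
  \<comment> \<open>Only an inclusion: if \<open>'i\<close> is too small for the cardinality
    condition, there are no such ideals and the union is empty. Its span is {0} all the
    same.\<close>
  then have "\<Union>{I. rb_ideal TYPE('i) I L} \<subseteq> {\<zero>\<^bsub>L\<^esub>}" by auto
  then have "lie_span L (\<Union>{I. rb_ideal TYPE('i) I L}) = {\<zero>\<^bsub>L\<^esub>}"
    unfolding lie_span_def
    by (rule hull_unique)
       (simp_all add: submodule_zero L lie_submodule_iff[OF L, THEN iffD1])
  then show ?thesis by (simp add: rb_semisimple_def baer_radical_def)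
qed

section \<open>The Witt algebras\<close>

lemma laurent_derivations_simps [simp]:
  "D \<in> carrier laurent_derivations \<longleftrightarrow> laurent_derivation D"
  "D \<otimes>\<^bsub>laurent_derivations\<^esub> E = (\<lambda>p. D (E p) - E (D p))"
  "\<zero>\<^bsub>laurent_derivations\<^esub> = (\<lambda>_. 0)"
  "D \<oplus>\<^bsub>laurent_derivations\<^esub> E = (\<lambda>p. D p + E p)"
  "c \<odot>\<^bsub>laurent_derivations\<^esub> D = (\<lambda>p. Poly_Mapping.single 0 c * D p)"
  by (simp_all add: laurent_derivations_def)

lemma laurent_derivation_diff: "laurent_derivation D \<Longrightarrow> D (p - q) = D p - D q"
  by (metis add_diff_cancel diff_add_cancel laurent_derivation_def)

text \<open>The Leibniz rule at 1 = 1 * 1 gives D 1 = D 1 + D 1, so D 1 = 0; constants follow by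
  linearity.\<close>

lemma laurent_derivation_const:
  assumes "laurent_derivation D"
  shows "D (Poly_Mapping.single 0 c) = 0"
proof -
  have D1: "D (1 * 1) = D 1 * 1 + 1 * D 1"
    and "D (Poly_Mapping.single 0 c * 1) = Poly_Mapping.single 0 c * D 1"
    using assms unfolding laurent_derivation_def by blast+
  moreover have "D 1 = 0"
    using D1 unfolding mult_1_left mult_1_right by (simp only: add_cancel_right_right)
  ultimately show ?thesis by simp
qed

text \<open>The commutator of D and E is a derivation because the mixed terms D p * E q and E p * D
  q are symmetric in D and E and cancel. The Jacobi identity holds for commutators of additive
  maps.\<close>

lemma lie_algebra_laurent_derivations:
  "lie_algebra (laurent_derivations :: ('f::field, 'f laurent_poly \<Rightarrow> 'f laurent_poly) module)"
    (is "lie_algebra ?L")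
proof -
  have add: "laurent_derivation (\<lambda>p. D p + E p)"
    and bracket: "laurent_derivation (\<lambda>p. D (E p) - E (D p))"
    if "laurent_derivation D" "laurent_derivation E"
    for D E :: "'f laurent_poly \<Rightarrow> 'f laurent_poly"
    using that that[THEN laurent_derivation_const]
    by (simp_all add: laurent_derivation_def algebra_simps)
  have smult: "laurent_derivation (\<lambda>p. Poly_Mapping.single 0 c * D p)"
    if "laurent_derivation D" for c and D :: "'f laurent_poly \<Rightarrow> 'f laurent_poly"
    using that that[THEN laurent_derivation_const]
    by (auto simp: laurent_derivation_def algebra_simps)
  have zero: "laurent_derivation (\<lambda>_. 0 :: 'f laurent_poly)"
    by (simp add: laurent_derivation_def)
  have "abelian_group ?L"
  proof (rule abelian_groupI)
    fix D assume "D \<in> carrier ?L"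
    then show "\<exists>E\<in>carrier ?L. E \<oplus>\<^bsub>?L\<^esub> D = \<zero>\<^bsub>?L\<^esub>"
      using smult[of D "-1"]
      by (intro bexI[of _ "\<lambda>p. Poly_Mapping.single 0 (-1) * D p"])
         (auto simp: single_uminus)
  qed (use add zero in \<open>auto simp: algebra_simps\<close>)
  then have mod: "Module.module ring_of_type_algebra ?L"
    by (intro moduleI)
       (use smult in \<open>auto simp: cring_from_type_algebra single_add algebra_simps mult_single\<close>)
  show ?thesis
    unfolding lie_algebra_def
    by (intro conjI mod)
       (auto simp: bracket laurent_derivation_diff fun_eq_iff,
        auto simp: laurent_derivation_def algebra_simps)
qed

section \<open>Elements of Witt spans as vector fields f d/dt\<close>

definition vector_field :: "'f::field laurent_poly \<Rightarrow> 'f laurent_poly \<Rightarrow> 'f laurent_poly" where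
  "vector_field f = (\<lambda>p. f * laurent_deriv p)"

text \<open>d/dt sends t to 1, so evaluation at t recovers the coefficient f. Hence f is a faithful
  coordinate for the operator.\<close>

lemma vector_field_apply_t: "vector_field f (Poly_Mapping.single 1 1) = f"
  by (simp add: vector_field_def laurent_deriv_single)

lemma vector_field_eq_0_iff: "vector_field f = (\<lambda>_. 0) \<longleftrightarrow> f = 0"
  by (metis vector_field_apply_t vector_field_def mult_zero_left)

lemma witt_basis_eq_vector_field: "witt_basis i = vector_field (Poly_Mapping.single (i + 1) 1)"
  by (simp add: fun_eq_iff witt_basis_def vector_field_def)

text \<open>The index drops by one because d_i has coefficient t^(i+1).\<close>

lemma vector_field_single:
  "vector_field (Poly_Mapping.single k c) =
    (\<lambda>p. Poly_Mapping.single 0 c * witt_basis (k - 1) p)"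
  by (simp add: fun_eq_iff witt_basis_def vector_field_def mult_single flip: mult.assoc)

lemma witt_basis_nonzero: "witt_basis i \<noteq> (\<lambda>_. 0)"
  unfolding witt_basis_eq_vector_field vector_field_eq_0_iff
  by (metis lookup_single_eq lookup_zero zero_neq_one)

lemma witt_basis_subset: "witt_basis ` J \<subseteq> carrier laurent_derivations"
  by (auto simp: witt_basis_derivation)

lemma submodule_witt_span:
  "submodule (carrier (witt_span J)) ring_of_type_algebra laurent_derivations"
  using submodule_lie_span[OF lie_algebra_laurent_derivations witt_basis_subset]
  by (simp add: witt_span_def)

lemma witt_span_simps [simp]:
  "D \<otimes>\<^bsub>witt_span J\<^esub> E = (\<lambda>p. D (E p) - E (D p))"
  "\<zero>\<^bsub>witt_span J\<^esub> = (\<lambda>_. 0)"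
  "D \<oplus>\<^bsub>witt_span J\<^esub> E = (\<lambda>p. D p + E p)"
  "c \<odot>\<^bsub>witt_span J\<^esub> D = (\<lambda>p. Poly_Mapping.single 0 c * D p)"
  by (simp_all add: witt_span_def laurent_derivations_def)

lemma witt_basis_in_witt_span: "i \<in> J \<Longrightarrow> witt_basis i \<in> carrier (witt_span J)"
  unfolding witt_span_def using lie_span_superset[of "witt_basis ` J"] by auto

text \<open>The operators f d/dt form a submodule containing every d_i. This gives each element of a
  Witt span a Laurent polynomial whose finite support can be counted.\<close>

lemma witt_span_subset_vector_fields:
  "carrier (witt_span J :: ('f::field, _) module) \<subseteq> range vector_field"
proof -
  have "submodule (range vector_field) ring_of_type_algebra
      (laurent_derivations :: ('f, 'f laurent_poly \<Rightarrow> 'f laurent_poly) module)"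
    unfolding lie_submodule_iff[OF lie_algebra_laurent_derivations]
  proof (intro conjI ballI allI)
    show "range vector_field \<subseteq> carrier laurent_derivations"
      by (auto simp: vector_field_def laurent_derivation_def laurent_deriv_add laurent_deriv_mult
          laurent_deriv_single algebra_simps)
    show "\<zero>\<^bsub>laurent_derivations\<^esub> \<in> range vector_field"
      by (auto simp: vector_field_def intro!: image_eqI[where x = 0])
    fix D E :: "'f laurent_poly \<Rightarrow> 'f laurent_poly"
    assume D: "D \<in> range vector_field"
    show "c \<odot>\<^bsub>laurent_derivations\<^esub> D \<in> range vector_field" for c
    proof -
      obtain f where "D = vector_field f" using D by auto
      then have "c \<odot>\<^bsub>laurent_derivations\<^esub> D = vector_field (Poly_Mapping.single 0 c * f)"
        by (simp add: vector_field_def mult.assoc)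
      then show ?thesis by blast
    qed
    assume "E \<in> range vector_field"
    with D obtain f g where "D = vector_field f" "E = vector_field g" by auto
    then have "D \<oplus>\<^bsub>laurent_derivations\<^esub> E = vector_field (f + g)"
      by (simp add: vector_field_def distrib_right)
    then show "D \<oplus>\<^bsub>laurent_derivations\<^esub> E \<in> range vector_field" by blast
  qed
  then have "lie_span laurent_derivations (witt_basis ` J) \<subseteq> range (vector_field :: 'f laurent_poly \<Rightarrow> _)"
    by (rule lie_span_minimal[rotated]) (auto simp: witt_basis_eq_vector_field)
  then show ?thesis by (simp add: witt_span_def)
qed

text \<open>Since [d_i, d_i] = 0, only sums of distinct indices have to stay in J. This matters for
  \<open>{-1..}\<close>, which does not contain -2.\<close>

lemma lie_algebra_witt_span:
  assumes closed: "\<And>i j. i \<in> J \<Longrightarrow> j \<in> J \<Longrightarrow> i \<noteq> j \<Longrightarrow> i + j \<in> J"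
  shows "lie_algebra (witt_span J :: ('f::field, 'f laurent_poly \<Rightarrow> 'f laurent_poly) module)"
proof -
  let ?D = "laurent_derivations :: ('f, 'f laurent_poly \<Rightarrow> 'f laurent_poly) module"
  let ?S = "lie_span ?D (witt_basis ` J)"
  have S: "submodule ?S ring_of_type_algebra ?D"
    by (rule submodule_lie_span[OF lie_algebra_laurent_derivations witt_basis_subset])
  have "witt_basis i \<otimes>\<^bsub>?D\<^esub> witt_basis j \<in> ?S" if "i \<in> J" "j \<in> J" for i j
  proof -
    have "of_int (j - i) \<odot>\<^bsub>?D\<^esub> witt_basis (i + j) \<in> ?S"
    proof (cases "i = j")
      case True
      then show ?thesis
        using S unfolding lie_submodule_iff[OF lie_algebra_laurent_derivations] by simp
    next
      case False
      then have "witt_basis (i + j) \<in> ?S"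
        using closed[OF that] witt_basis_in_witt_span[of "i + j" J] by (simp add: witt_span_def)
      then show ?thesis
        using S unfolding lie_submodule_iff[OF lie_algebra_laurent_derivations] by blast
    qed
    then show ?thesis by (simp only: witt_basis_bracket)
  qed
  then have gen: "x \<otimes>\<^bsub>?D\<^esub> y \<in> ?S" if "x \<in> witt_basis ` J" "y \<in> witt_basis ` J" for x y
    using that by (elim imageE) (simp only:)
  show ?thesis
    unfolding witt_span_def
    by (rule lie_subalgebra[OF lie_algebra_laurent_derivations S])
       (rule lie_span_bracket_closed[OF lie_algebra_laurent_derivations witt_basis_subset gen])
qed

text \<open>For vector fields, [g d/dt, f d/dt] = (g f' - f g') d/dt; here g = t.\<close>

lemma witt_basis_0_bracket_vector_field:
  "witt_basis 0 \<otimes>\<^bsub>witt_span J\<^esub> vector_field f =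
    vector_field (Poly_Mapping.single 1 1 * laurent_deriv f - f)"
  by (simp add: fun_eq_iff witt_basis_def vector_field_def laurent_deriv_mult laurent_deriv_single
      algebra_simps flip: single_one)

text \<open>The operator t d/dt is diagonal on monomials, with the exponent as eigenvalue. This is
  what lets an ideal separate the terms of its elements.\<close>

lemma lookup_t_deriv:
  "Poly_Mapping.lookup (Poly_Mapping.single 1 1 * laurent_deriv f) k =
    of_int k * Poly_Mapping.lookup f k"
proof (induction f rule: laurent_poly_induct)
  case (add p q)
  then show ?case by (simp add: laurent_deriv_add distrib_left lookup_add)
next
  case (single j c)
  then show ?case by (simp add: laurent_deriv_single mult_single lookup_single when_def)
qed

lemma lookup_const_mult:
  fixes f :: "'f::field laurent_poly"
  shows "Poly_Mapping.lookup (Poly_Mapping.single 0 c * f) k = c * Poly_Mapping.lookup f k"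
proof (induction f rule: laurent_poly_induct)
  case (add p q)
  then show ?case by (simp add: distrib_left lookup_add)
next
  case (single j d)
  then show ?case by (simp add: mult_single lookup_single when_def)
qed

section \<open>Ideals of a Witt span\<close>

context
  fixes J :: "int set" and I :: "('f::field_char_0 laurent_poly \<Rightarrow> 'f laurent_poly) set"
  assumes units: "{-1, 0, 1} \<subseteq> J"
    and closed: "\<And>i j. i \<in> J \<Longrightarrow> j \<in> J \<Longrightarrow> i \<noteq> j \<Longrightarrow> i + j \<in> J"
    and ideal: "lie_ideal I (witt_span J)"
begin

lemma witt_ideal_closed:
  shows "I \<subseteq> carrier (witt_span J)" "(\<lambda>_. 0) \<in> I"
    "D \<in> I \<Longrightarrow> E \<in> I \<Longrightarrow> (\<lambda>p. D p + E p) \<in> I"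
    "D \<in> I \<Longrightarrow> (\<lambda>p. Poly_Mapping.single 0 c * D p) \<in> I"
    "i \<in> J \<Longrightarrow> D \<in> I \<Longrightarrow> witt_basis i \<otimes>\<^bsub>witt_span J\<^esub> D \<in> I"
proof -
  have W: "lie_algebra (witt_span J :: ('f, 'f laurent_poly \<Rightarrow> 'f laurent_poly) module)"
    using closed by (rule lie_algebra_witt_span)
  have "submodule I ring_of_type_algebra (witt_span J)"
    and bracket: "\<forall>D\<in>carrier (witt_span J). \<forall>E\<in>I. D \<otimes>\<^bsub>witt_span J\<^esub> E \<in> I"
    using ideal unfolding lie_ideal_def by blast+
  then show "I \<subseteq> carrier (witt_span J)" "(\<lambda>_. 0) \<in> I"
    "D \<in> I \<Longrightarrow> E \<in> I \<Longrightarrow> (\<lambda>p. D p + E p) \<in> I"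
    "D \<in> I \<Longrightarrow> (\<lambda>p. Poly_Mapping.single 0 c * D p) \<in> I"
    unfolding lie_submodule_iff[OF W] witt_span_simps by blast+
  show "i \<in> J \<Longrightarrow> D \<in> I \<Longrightarrow> witt_basis i \<otimes>\<^bsub>witt_span J\<^esub> D \<in> I"
    using bracket witt_basis_in_witt_span by blast
qed

lemma witt_ideal_smult_cancel:
  assumes "(\<lambda>p. Poly_Mapping.single 0 c * D p) \<in> I" "c \<noteq> 0"
  shows "D \<in> I"
  using witt_ideal_closed(4)[OF assms(1), of "1 / c"] assms(2)
  by (simp add: mult_single flip: mult.assoc)

text \<open>The bracket of d_i and d_j is (j - i) d_{i+j}, and characteristic zero makes j - i
  invertible in the field.\<close>

lemma witt_ideal_shift:
  assumes "witt_basis j \<in> I" "i \<in> J" "i \<noteq> j"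
  shows "witt_basis (i + j) \<in> I"
proof -
  have "witt_basis i \<otimes>\<^bsub>laurent_derivations\<^esub> witt_basis j \<in> I"
    using witt_ideal_closed(5)[OF assms(2,1)]
    unfolding witt_span_simps laurent_derivations_simps .
  then have "of_int (j - i) \<odot>\<^bsub>laurent_derivations\<^esub> witt_basis (i + j) \<in> I"
    by (simp only: witt_basis_bracket)
  then have "(\<lambda>p. Poly_Mapping.single 0 (of_int (j - i)) * witt_basis (i + j) p) \<in> I"
    by (simp only: laurent_derivations_simps)
  moreover have "of_int (j - i) \<noteq> (0 :: 'f)"
    using assms(3) by simp
  ultimately show ?thesis by (rule witt_ideal_smult_cancel)
qed

text \<open>Induction on the absolute value of j. The shift by -1 or 1 has the sign opposite to j,
  so it moves towards 0 and always differs from j.\<close>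

lemma witt_ideal_basis_0: "witt_basis j \<in> I \<Longrightarrow> witt_basis 0 \<in> I"
proof (induction "nat \<bar>j\<bar>" arbitrary: j)
  case (Suc n)
  show ?case
  proof (cases "j > 0")
    case True
    with Suc.prems have "witt_basis (-1 + j) \<in> I"
      using units by (intro witt_ideal_shift) auto
    moreover have "n = nat \<bar>-1 + j\<bar>" using Suc.hyps True by auto
    ultimately show ?thesis using Suc.hyps by blast
  next
    case False
    with Suc have "witt_basis (1 + j) \<in> I"
      using units by (intro witt_ideal_shift) auto
    moreover have "n = nat \<bar>1 + j\<bar>" using Suc.hyps False by auto
    ultimately show ?thesis using Suc.hyps by blast
  qed
qed simp

lemma witt_ideal_full:
  assumes "witt_basis 0 \<in> I"
  shows "I = carrier (witt_span J)"
proof -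
  have "witt_basis j \<in> I" if "j \<in> J" for j
    \<comment> \<open>[d_j, d_0] is a non-zero multiple of d_j unless j = 0.\<close>
    using witt_ideal_shift[OF assms that] assms by (cases "j = 0") auto
  \<comment> \<open>The span defining \<open>witt_span\<close> is taken among all derivations, so I
    is compared with it there.\<close>
  moreover have "submodule I ring_of_type_algebra laurent_derivations"
    unfolding lie_submodule_iff[OF lie_algebra_laurent_derivations]
    using submodule_subset[OF submodule_witt_span[of J]] witt_ideal_closed(1-4)
    by (auto simp del: laurent_derivations_simps(1))
  ultimately have "carrier (witt_span J) \<subseteq> I"
    unfolding witt_span_def using lie_span_minimal[of "witt_basis ` J" I] by auto
  then show ?thesis using witt_ideal_closed(1) by blast
qed

text \<open>Minimal support appears as induction on the number of exponents of f: either f is a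
  single term, or a non-zero element with fewer terms lies in I.\<close>

lemma witt_ideal_contains_basis:
  assumes "vector_field f \<in> I" "f \<noteq> 0"
  shows "\<exists>j. witt_basis j \<in> I"
  using assms
proof (induction "card (Poly_Mapping.keys f)" arbitrary: f rule: less_induct)
  case less
  obtain k where k: "k \<in> Poly_Mapping.keys f"
    using less.prems(2) keys_eq_empty by blast
  \<comment> \<open>\<open>t\<^sup>k\<close> stands for \<open>d\<^bsub>k-1\<^esub>\<close>, so \<open>g\<close> represents \<open>[d\<^sub>0, x] - (k - 1) x\<close>.\<close>
  define g where "g = Poly_Mapping.single 1 1 * laurent_deriv f - f
    + Poly_Mapping.single 0 (of_int (1 - k)) * f"
  \<comment> \<open>The factor j - k removes exponent k and creates no new exponent.\<close>
  have lookup_g: "Poly_Mapping.lookup g j = of_int (j - k) * Poly_Mapping.lookup f j" for j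
    unfolding g_def lookup_add lookup_minus lookup_t_deriv lookup_const_mult
    by (simp add: algebra_simps)
  have "vector_field g \<in> I"
  proof -
    have "(\<lambda>p. vector_field (Poly_Mapping.single 1 1 * laurent_deriv f - f) p
        + Poly_Mapping.single 0 (of_int (1 - k)) * vector_field f p) \<in> I"
      using units less.prems(1)
      by (intro witt_ideal_closed(3,4))
         (auto simp flip: witt_basis_0_bracket_vector_field[of J] simp del: witt_span_simps
           intro: witt_ideal_closed(5))
    then show ?thesis
      by (simp add: g_def vector_field_def algebra_simps)
  qed
  show ?case
  proof (cases "g = 0")
    case True
    \<comment> \<open>In characteristic zero the factor j - k vanishes only for j = k.\<close>
    then have "Poly_Mapping.lookup f j = 0" if "j \<noteq> k" for j
      using lookup_g[of j] that by simp
    then have f: "f = Poly_Mapping.single k (Poly_Mapping.lookup f k)"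
      by (intro poly_mapping_eqI) (auto simp: lookup_single when_def)
    \<comment> \<open>The single term c t^k d/dt is c d_{k-1}, and c is non-zero since k is in the
      support.\<close>
    have "(\<lambda>p. Poly_Mapping.single 0 (Poly_Mapping.lookup f k) * witt_basis (k - 1) p) \<in> I"
      using less.prems(1) by (simp only: trans[OF arg_cong[OF f, of vector_field] vector_field_single])
    then have "witt_basis (k - 1) \<in> I"
      by (rule witt_ideal_smult_cancel) (use k in \<open>simp add: in_keys_iff\<close>)
    then show ?thesis ..
  next
    case False
    have "Poly_Mapping.keys g \<subset> Poly_Mapping.keys f"
      using k lookup_g by (auto simp: in_keys_iff)
    then show ?thesis
      using less.hyps[OF psubset_card_mono] \<open>vector_field g \<in> I\<close> False finite_keys by blast
  qed
qed

lemma witt_ideal_trivial: "I = {\<lambda>_. 0} \<or> I = carrier (witt_span J)"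
proof (cases "I \<subseteq> {\<lambda>_. 0}")
  case False
  then obtain f where "vector_field f \<in> I" "f \<noteq> 0"
    using witt_ideal_closed(1) witt_span_subset_vector_fields[of J] vector_field_eq_0_iff by blast
  then show ?thesis
    using witt_ideal_contains_basis witt_ideal_basis_0 witt_ideal_full by blast
qed (use witt_ideal_closed(2) in blast)

end

section \<open>Simplicity of both Witt algebras\<close>

lemma simple_lie_algebra_witt_span:
  assumes units: "{-1, 0, 1} \<subseteq> J"
    and closed: "\<And>i j. i \<in> J \<Longrightarrow> j \<in> J \<Longrightarrow> i \<noteq> j \<Longrightarrow> i + j \<in> J"
  shows "simple_lie_algebra
    (witt_span J :: ('f::field_char_0, 'f laurent_poly \<Rightarrow> 'f laurent_poly) module)"
    (is "simple_lie_algebra ?W")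
proof -
  \<comment> \<open>[d_0, d_1] = d_1 is a non-zero element of [W, W].\<close>
  have "witt_basis 0 \<otimes>\<^bsub>?W\<^esub> witt_basis 1 = of_int (1 - 0) \<odot>\<^bsub>?W\<^esub> witt_basis (0 + 1)"
    using witt_basis_bracket[where 'a = 'f, of 0 1] by simp
  then have "witt_basis 1 = witt_basis 0 \<otimes>\<^bsub>?W\<^esub> witt_basis 1"
    by (simp del: witt_span_simps(1))
  moreover have "witt_basis 0 \<in> carrier ?W" "witt_basis 1 \<in> carrier ?W"
    using units by (auto intro: witt_basis_in_witt_span)
  ultimately have "witt_basis 1 \<in> {x \<otimes>\<^bsub>?W\<^esub> y |x y. x \<in> carrier ?W \<and> y \<in> carrier ?W}"
    by blast
  then have "witt_basis 1 \<in> lie_product ?W (carrier ?W) (carrier ?W)"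
    unfolding lie_product_def by (rule subsetD[OF lie_span_superset])
  then have "lie_product ?W (carrier ?W) (carrier ?W) \<noteq> {\<zero>\<^bsub>?W\<^esub>}"
    using witt_basis_nonzero[of 1] by auto
  then show ?thesis
    unfolding simple_lie_algebra_def
    using lie_algebra_witt_span[OF closed] witt_ideal_trivial[OF units closed] by auto
qed

theorem proposition6p3:
  shows "simple_lie_algebra (witt_poly ::
            ('f::{alg_closed_field, field_char_0}, 'f laurent_poly \<Rightarrow> 'f laurent_poly) module) \<and>
         simple_lie_algebra (witt_laurent ::
            ('f, 'f laurent_poly \<Rightarrow> 'f laurent_poly) module) \<and>
         rb_semisimple TYPE('i) (witt_poly ::
            ('f, 'f laurent_poly \<Rightarrow> 'f laurent_poly) module) \<and>
         rb_semisimple TYPE('i) (witt_laurent ::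
            ('f, 'f laurent_poly \<Rightarrow> 'f laurent_poly) module)"
proof -
  have "simple_lie_algebra (witt_poly :: ('f, 'f laurent_poly \<Rightarrow> 'f laurent_poly) module)"
    \<comment> \<open>Distinct i, j \<ge> -1 satisfy i + j \<ge> -1, since at most one of them
      equals -1.\<close>
    unfolding witt_poly_def by (rule simple_lie_algebra_witt_span) auto
  moreover have "simple_lie_algebra (witt_laurent :: ('f, 'f laurent_poly \<Rightarrow> 'f laurent_poly) module)"
    unfolding witt_laurent_def by (rule simple_lie_algebra_witt_span) auto
  ultimately show ?thesis using simple_imp_rb_semisimple by blast
qed

end
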